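(* Let $H$ be a finite simple undirected graph on $V=[n]$, let $\mathbf x_1,\dots,\mathbf x_n\in\mathbb R^d$, let $\lambda>0$, let $\emptyset\ne S\subseteq V$, and let $k\ge 0$ be an integer. Let $S_1,\dots,S_c$ be the (vertex sets of the) connected components of $H[S]$ and define $$\mathcal K_H(S,k)=\Big\{\mathbf k=(k_1,\dots,k_c)\in\mathbb Z^c:\ 1\le k_j\le|S_j|,\ \sum_{j=1}^c k_j=k\Big\}.$$ Let $\mathcal P_{H,k}(S)$ be the set of partitions of $S$ into exactly $k$ nonempty blocks each inducing a connected subgraph of $H$. Then restriction to components, $\ell\mapsto(\{A\in\ell:A\subseteq S_j\})_{j=1}^c$, gives a bijection $$\mathcal P_{H,k}(S)\cong\bigsqcup_{\mathbf k\in\mathcal K_H(S,k)}\ \prod_{j=1}^c\mathcal P_{H,k_j}(S_j),$$ and consequently $$F_H(S,k)=\min_{\mathbf k\in\mathcal K_H(S,k)}\sum_{j=1}^cF_H(S_j,k_j),\qquad F_{H,\lambda}(S)=\sum_{j=1}^cF_{H,\lambda}(S_j),$$ $$\mathcal P_{H,k}(S)\ne\emptyset\iff c\le k\le|S|.$$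
   Context: $V=[n]$ indexes the observations. For nonempty $A\subseteq V$, $\phi_{\mathrm{SSE}}(A)=\sum_{i\in A}\|\mathbf x_i-\boldsymbol\mu(A)\|^2$ with $\boldsymbol\mu(A)=|A|^{-1}\sum_{i\in A}\mathbf x_i$. Convention: $\min\emptyset=+\infty$. $H[A]$ is the induced subgraph and $\mathcal C(H)=\{A\subseteq V:A\ne\emptyset,\ H[A]\text{ connected}\}$. For nonempty $S$ and $1\le k\le|S|$: $\mathcal A_H(S,k)=\{B\in\mathcal C(H):B\subseteq S,\ \min S\in B,\ |B|\le|S|-k+1\}$, and $\mathcal A_{H,\lambda}(S)=\{B\in\mathcal C(H):B\subseteq S,\ \min S\in B\}$. $F_H$ is defined by $F_H(\emptyset,0)=0$; $F_H(S,k)=+\infty$ if $k=0<|S|$ or $k>|S|$; and for $S\neq\emptyset$, $1\le k\le|S|$, $F_H(S,k)=\min_{B\in\mathcal A_H(S,k)}\{\phi_{\mathrm{SSE}}(B)+F_H(S\setminus B,k-1)\}$. $F_{H,\lambda}$ is defined by $F_{H,\lambda}(\emptyset)=0$ and, for $S\ne\emptyset$, $F_{H,\lambda}(S)=\min_{B\in\mathcal A_{H,\lambda}(S)}\{\phi_{\mathrm{SSE}}(B)+\lambda+F_{H,\lambda}(S\setminus B)\}$. *)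

theory Defs
  imports "HOL-Analysis.Analysis" "HOL-Library.Disjoint_Sets" "Graph_Theory.Graph_Theory"
begin

text \<open>
  A finite simple undirected graph is a loop-free symmetric finite digraph whose arcs are pairs of
  vertices, i.e. a \<^typ>\<open>nat pair_pre_digraph\<close> satisfying \<^const>\<open>pair_graph\<close>. The graph-theoretic
  \<open>connected\<close> is written qualified because of the topological constant of the same name; it requires
  a nonempty vertex set.
\<close>

definition conn_sets :: "nat pair_pre_digraph \<Rightarrow> nat set set" where
  "conn_sets H = {A. A \<subseteq> pverts H \<and> A \<noteq> {} \<and> Digraph_Component.connected (with_proj H \<restriction> A)}"

text \<open>Vertex sets of the connected components, i.e. of the maximal connected subgraphs, of \<open>H[S]\<close>.\<close>

definition component_sets :: "nat pair_pre_digraph \<Rightarrow> nat set \<Rightarrow> nat set set" where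
  "component_sets H S =
     verts ` {C. pre_digraph.max_subgraph (with_proj H \<restriction> S) Digraph_Component.connected C}"

definition conn_partitions :: "nat pair_pre_digraph \<Rightarrow> nat \<Rightarrow> nat set \<Rightarrow> nat set set set" where
  "conn_partitions H k S = {L. partition_on S L \<and> card L = k \<and> L \<subseteq> conn_sets H}"

definition centroid :: "(nat \<Rightarrow> real ^ 'd) \<Rightarrow> nat set \<Rightarrow> real ^ 'd" where
  "centroid x A = (1 / real (card A)) *\<^sub>R (\<Sum>i\<in>A. x i)"

definition sse :: "(nat \<Rightarrow> real ^ 'd) \<Rightarrow> nat set \<Rightarrow> real" where
  "sse x A = (\<Sum>i\<in>A. (norm (x i - centroid x A))\<^sup>2)"

text \<open>Only used for finite sets, on which \<^const>\<open>Min\<close> is meaningful.\<close>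

definition min_or_infinity :: "ereal set \<Rightarrow> ereal" where
  "min_or_infinity X = (if X = {} then \<infinity> else Min X)"

definition root_blocks :: "nat pair_pre_digraph \<Rightarrow> nat set \<Rightarrow> nat set set" where
  "root_blocks H S = {B \<in> conn_sets H. B \<subseteq> S \<and> Min S \<in> B}"

text \<open>Only used for \<open>1 \<le> k \<le> card S\<close>, so that the subtraction does not truncate.\<close>

definition root_blocks_card :: "nat pair_pre_digraph \<Rightarrow> nat set \<Rightarrow> nat \<Rightarrow> nat set set" where
  "root_blocks_card H S k =
     {B \<in> conn_sets H. B \<subseteq> S \<and> Min S \<in> B \<and> card B \<le> card S - k + 1}"

function opt_card ::
  "nat pair_pre_digraph \<Rightarrow> (nat \<Rightarrow> real ^ 'd) \<Rightarrow> nat set \<Rightarrow> nat \<Rightarrow> ereal" where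
  "opt_card H x S k =
     (if S = {} \<and> k = 0 then 0
      else if k = 0 \<or> card S < k then \<infinity>
      else min_or_infinity ((\<lambda>B. ereal (sse x B) + opt_card H x (S - B) (k - 1)) ` root_blocks_card H S k))"
  by pat_completeness auto
termination
  by (relation "Wellfounded.measure (\<lambda>(H, x, S, k). k)") auto

declare opt_card.simps [simp del]

text \<open>The value on infinite sets is arbitrary; it only makes the recursion total.\<close>

context
  notes image_cong [fundef_cong]
begin

function opt_pen ::
  "nat pair_pre_digraph \<Rightarrow> (nat \<Rightarrow> real ^ 'd) \<Rightarrow> real \<Rightarrow> nat set \<Rightarrow> ereal" where
  "opt_pen H x l S =
     (if S = {} then 0
      else if infinite S then \<infinity>
      else min_or_infinity ((\<lambda>B. ereal (sse x B) + ereal l + opt_pen H x l (S - B)) ` root_blocks H S))"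
  by pat_completeness auto
termination
proof (relation "Wellfounded.measure (\<lambda>(H, x, l, S). card S)", goal_cases)
  case (2 H x l S B)
  then have "finite S" "B \<subseteq> S" "Min S \<in> B"
    by (auto simp: root_blocks_def)
  then have "S - B \<subset> S" by blast
  with \<open>finite S\<close> show ?case by (simp add: psubset_card_mono)
qed simp

end

declare opt_pen.simps [simp del]

text \<open>
  The tuples \<open>(k\<^sub>1, \<dots>, k\<^sub>c)\<close> are functions on \<open>{1..c}\<close> (extended by \<^const>\<open>undefined\<close>), and \<open>T j\<close>
  stands for the \<open>j\<close>-th component. Being positive, the \<open>k\<^sub>j\<close> can be taken in \<^typ>\<open>nat\<close>.
\<close>

definition size_tuples :: "nat \<Rightarrow> (nat \<Rightarrow> nat set) \<Rightarrow> nat \<Rightarrow> (nat \<Rightarrow> nat) set" where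
  "size_tuples c T k =
     {\<kappa> \<in> (\<Pi>\<^sub>E j\<in>{1..c}. {1..card (T j)}). (\<Sum>j = 1..c. \<kappa> j) = k}"

definition restrict_parts :: "nat \<Rightarrow> (nat \<Rightarrow> nat set) \<Rightarrow> nat set set \<Rightarrow> (nat \<Rightarrow> nat set set)" where
  "restrict_parts c T L = (\<lambda>j\<in>{1..c}. {A \<in> L. A \<subseteq> T j})"

text \<open>
  A point of the disjoint union over \<open>\<kappa>\<close> is a pair of its index \<open>\<kappa>\<close> and a member of the
  corresponding product; the index belonging to a partition lists the numbers of blocks of its
  restrictions.
\<close>

definition split_partition ::
  "nat \<Rightarrow> (nat \<Rightarrow> nat set) \<Rightarrow> nat set set \<Rightarrow> (nat \<Rightarrow> nat) \<times> (nat \<Rightarrow> nat set set)" where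
  "split_partition c T L = ((\<lambda>j\<in>{1..c}. card (restrict_parts c T L j)), restrict_parts c T L)"

end

theory Submission
  imports Defs
begin

text \<open>
  Every connected subset of \<open>S\<close> lies in exactly one component of \<open>H[S]\<close>, so a partition of \<open>S\<close> into
  connected blocks is the same as a family of such partitions of the components. Peeling off the block
  containing \<open>Min S\<close> shows that both recursions compute the infimum of the total cost over such
  partitions, and the infimum of a separable cost over a product is the sum of the infima. All numbers
  of blocks between \<open>c\<close> and \<open>card S\<close> occur: start from the singletons, and as long as there are more
  blocks than components, some component contains two blocks and hence two blocks joined by an edge,
  which can be merged.
\<close>

subsection \<open>Connected vertex sets and components\<close>

text \<open>If \<open>v\<close> is not reachable from \<open>u\<close>, the vertices reachable from
  \<open>u\<close> form a cut that no edge leaves. The cut form lets unions of connected sets be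
  treated without handling walks.\<close>

lemma connected_iff_cut:
  "Digraph_Component.connected G \<longleftrightarrow>
     verts G \<noteq> {} \<and>
     (\<forall>X. X \<subset> verts G \<and> X \<noteq> {} \<longrightarrow> (\<exists>a\<in>X. \<exists>b\<in>verts G - X. (a, b) \<in> (arcs_ends G)\<^sup>s))"
  (is "?L \<longleftrightarrow> verts G \<noteq> {} \<and> ?R")
proof (intro iffI conjI allI impI)
  assume ?L
  then show "verts G \<noteq> {}" by (simp add: connected_conv)
next
  fix X assume con: ?L and X: "X \<subset> verts G \<and> X \<noteq> {}"
  then obtain u v where uv: "u \<in> X" "v \<in> verts G" "v \<notin> X" by blast
  with con X have "(u, v) \<in> rtrancl_on (verts G) ((arcs_ends G)\<^sup>s)"
    by (auto simp: connected_conv)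
  then have "v \<in> X \<or> (\<exists>a\<in>X. \<exists>b\<in>verts G - X. (a, b) \<in> (arcs_ends G)\<^sup>s)"
    by (induction rule: rtrancl_on_induct) (use uv in auto)
  with uv show "\<exists>a\<in>X. \<exists>b\<in>verts G - X. (a, b) \<in> (arcs_ends G)\<^sup>s" by blast
next
  assume R: "verts G \<noteq> {} \<and> ?R"
  have "(u, v) \<in> rtrancl_on (verts G) ((arcs_ends G)\<^sup>s)"
    if u: "u \<in> verts G" and v: "v \<in> verts G" for u v
  proof (rule ccontr)
    define X where "X = {w. (u, w) \<in> rtrancl_on (verts G) ((arcs_ends G)\<^sup>s)}"
    assume "(u, v) \<notin> rtrancl_on (verts G) ((arcs_ends G)\<^sup>s)"
    with v have "X \<subset> verts G" by (auto simp: X_def dest: in_rtrancl_on_in_F)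
    moreover have "u \<in> X" using u by (simp add: X_def)
    ultimately obtain a b where "a \<in> X" "b \<in> verts G - X" "(a, b) \<in> (arcs_ends G)\<^sup>s"
      using R by blast
    then show False by (auto simp: X_def intro: rtrancl_on_into_rtrancl_on)
  qed
  with R show ?L by (simp add: connected_conv)
qed

lemma arcs_ends_induce_with_proj [simp]:
  "arcs_ends (with_proj H \<restriction> A) = parcs H \<inter> A \<times> A"
  by (auto simp: arcs_ends_conv induce_subgraph_def image_iff)

lemma in_conn_sets_iff_cut:
  "A \<in> conn_sets H \<longleftrightarrow>
     A \<subseteq> pverts H \<and> A \<noteq> {} \<and>
     (\<forall>X. X \<subset> A \<and> X \<noteq> {} \<longrightarrow> (\<exists>a\<in>X. \<exists>b\<in>A - X. (a, b) \<in> (parcs H)\<^sup>s))"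
proof -
  have "(\<exists>a\<in>X. \<exists>b\<in>A - X. (a, b) \<in> (parcs H \<inter> A \<times> A)\<^sup>s) \<longleftrightarrow>
    (\<exists>a\<in>X. \<exists>b\<in>A - X. (a, b) \<in> (parcs H)\<^sup>s)" if "X \<subset> A" for X
    using that by (intro bex_cong refl) (auto simp: symcl_def)
  then show ?thesis
    by (simp add: conn_sets_def connected_iff_cut cong: conj_cong imp_cong)
qed

lemma conn_sets_cut:
  assumes "A \<in> conn_sets H" "X \<subset> A" "X \<noteq> {}"
  shows "\<exists>a\<in>X. \<exists>b\<in>A - X. (a, b) \<in> (parcs H)\<^sup>s"
  using assms by (simp add: in_conn_sets_iff_cut)

lemma conn_sets_nonempty: "A \<in> conn_sets H \<Longrightarrow> A \<noteq> {}"
  by (simp add: conn_sets_def)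

lemma singleton_in_conn_sets: "v \<in> pverts H \<Longrightarrow> {v} \<in> conn_sets H"
  by (auto simp: in_conn_sets_iff_cut)

text \<open>A cut of the union either splits \<open>A\<close> or \<open>B\<close>, or separates one
  from the other; in the latter case \<open>a = b\<close> is impossible and the edge between
  \<open>a\<close> and \<open>b\<close> crosses it.\<close>

lemma Un_in_conn_sets:
  assumes A: "A \<in> conn_sets H" and B: "B \<in> conn_sets H"
    and ab: "a \<in> A" "b \<in> B" "a = b \<or> (a, b) \<in> (parcs H)\<^sup>s"
  shows "A \<union> B \<in> conn_sets H"
  unfolding in_conn_sets_iff_cut
proof (intro conjI allI impI)
  show "A \<union> B \<subseteq> pverts H" "A \<union> B \<noteq> {}" using A B by (auto simp: conn_sets_def)
next
  fix X assume X: "X \<subset> A \<union> B \<and> X \<noteq> {}"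
  have sym: "(b, a) \<in> (parcs H)\<^sup>s" if "(a, b) \<in> (parcs H)\<^sup>s" using that by (auto simp: symcl_def)
  consider "X \<inter> A \<noteq> {} \<and> X \<inter> A \<subset> A" | "X \<inter> B \<noteq> {} \<and> X \<inter> B \<subset> B"
    | "A \<subseteq> X" "X \<inter> B = {}" | "B \<subseteq> X" "X \<inter> A = {}"
    using X by blast
  then show "\<exists>a\<in>X. \<exists>b\<in>A \<union> B - X. (a, b) \<in> (parcs H)\<^sup>s"
  proof cases
    case 1 with conn_sets_cut[OF A, of "X \<inter> A"] show ?thesis by blast
  next
    case 2 with conn_sets_cut[OF B, of "X \<inter> B"] show ?thesis by blast
  next
    case 3 with ab show ?thesis by blast
  next
    case 4 with ab sym show ?thesis by blast
  qed
qed

text \<open>A cut \<open>X\<close> of the union splits some member: one that is not inside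
  \<open>X\<close> if \<open>v\<close> lies in \<open>X\<close>, and one that meets \<open>X\<close>
  otherwise.\<close>

lemma Union_in_conn_sets:
  assumes F: "F \<subseteq> conn_sets H" "F \<noteq> {}" and v: "\<And>A. A \<in> F \<Longrightarrow> v \<in> A"
  shows "\<Union>F \<in> conn_sets H"
  unfolding in_conn_sets_iff_cut
proof (intro conjI allI impI)
  show "\<Union>F \<subseteq> pverts H" "\<Union>F \<noteq> {}" using F v by (auto simp: conn_sets_def)
next
  fix X assume X: "X \<subset> \<Union>F \<and> X \<noteq> {}"
  show "\<exists>a\<in>X. \<exists>b\<in>\<Union>F - X. (a, b) \<in> (parcs H)\<^sup>s"
  proof -
    have "\<exists>A\<in>F. X \<inter> A \<noteq> {} \<and> X \<inter> A \<subset> A"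
    proof (cases "v \<in> X")
      case True
      from X obtain A u where "A \<in> F" "u \<in> A" "u \<notin> X" by blast
      with True v show ?thesis by blast
    next
      case False
      from X obtain A u where "A \<in> F" "u \<in> A" "u \<in> X" by blast
      with False v show ?thesis by blast
    qed
    then obtain A where "A \<in> F" "X \<inter> A \<noteq> {}" "X \<inter> A \<subset> A" by blast
    with F conn_sets_cut[of A H "X \<inter> A"] show ?thesis by blast
  qed
qed

section \<open>Components as maximal connected vertex sets\<close>

text \<open>Maximal subgraphs compete with all subgraphs, not just the induced ones. Every edge of
  \<open>C\<close> is an edge of \<open>H\<close>, so the cut condition carries over.\<close>

lemma verts_connected_subgraph_in_conn_sets:
  assumes C: "subgraph C (with_proj H \<restriction> S)" "Digraph_Component.connected C"
    and S: "S \<subseteq> pverts H"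
  shows "verts C \<in> conn_sets H" "verts C \<subseteq> S"
proof -
  have arcs: "(arcs_ends C)\<^sup>s \<subseteq> (parcs H)\<^sup>s"
    using arcs_ends_mono[OF C(1)] by (auto simp: symcl_def)
  show "verts C \<subseteq> S" using C(1) by (auto simp: subgraph_def)
  with S have "verts C \<subseteq> pverts H" by simp
  with C(2) arcs show "verts C \<in> conn_sets H"
    unfolding in_conn_sets_iff_cut connected_iff_cut by blast
qed

lemma wf_digraph_induce_with_proj: "wf_digraph (with_proj H \<restriction> A)"
  by unfold_locales (auto simp: induce_subgraph_def)

text \<open>Adding all edges between its vertices keeps a subgraph connected, so a maximal connected
  subgraph is induced and maximality can be tested on vertex sets.\<close>

lemma component_sets_eq_maximal:
  assumes S: "S \<subseteq> pverts H"
  shows "component_sets H S =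
    {A \<in> conn_sets H. A \<subseteq> S \<and> (\<forall>B\<in>conn_sets H. B \<subseteq> S \<and> A \<subseteq> B \<longrightarrow> B = A)}"
    (is "_ = ?R")
proof (intro equalityI subsetI)
  fix A assume "A \<in> component_sets H S"
  then obtain C where A: "A = verts C"
    and C: "pre_digraph.max_subgraph (with_proj H \<restriction> S) Digraph_Component.connected C"
    by (auto simp: component_sets_def)
  have sub: "subgraph C (with_proj H \<restriction> S)" and con: "Digraph_Component.connected C"
    and max: "\<And>C'. C' \<noteq> C \<Longrightarrow> subgraph C C' \<Longrightarrow> subgraph C' (with_proj H \<restriction> S) \<Longrightarrow>
      \<not> Digraph_Component.connected C'"
    using C by (auto simp: pre_digraph.max_subgraph_def)
  have "B = A" if B: "B \<in> conn_sets H" "B \<subseteq> S" "A \<subseteq> B" for B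
  proof -
    \<comment> \<open>The subgraph induced by \<open>B\<close> is connected and lies between
      \<open>C\<close> and \<open>H[S]\<close>, so maximality of \<open>C\<close> forces
      equality.\<close>
    have "subgraph (with_proj H \<restriction> B) (with_proj H \<restriction> S)"
      using B(2) wf_digraph_induce_with_proj
      by (auto simp: subgraph_def induce_subgraph_def compatible_def)
    moreover have "subgraph C (with_proj H \<restriction> B)"
      using sub B(3) wf_digraph_induce_with_proj[of H B] wf_digraph.wellformed[of C]
      by (auto simp: A subgraph_def induce_subgraph_def compatible_def subset_iff)
    moreover have "Digraph_Component.connected (with_proj H \<restriction> B)"
      using B by (simp add: conn_sets_def)
    ultimately have "with_proj H \<restriction> B = C" using max by blast
    then show ?thesis unfolding A using induce_subgraph_verts by metis
  qed
  with verts_connected_subgraph_in_conn_sets[OF sub con S] show "A \<in> ?R"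
    by (auto simp: A)
next
  fix A assume A: "A \<in> ?R"
  let ?C = "with_proj H \<restriction> A"
  have "pre_digraph.max_subgraph (with_proj H \<restriction> S) Digraph_Component.connected ?C"
    unfolding pre_digraph.max_subgraph_def
  proof (intro conjI allI impI notI; (elim conjE)?)
    show "subgraph ?C (with_proj H \<restriction> S)"
      using A wf_digraph_induce_with_proj
      by (auto simp: subgraph_def induce_subgraph_def compatible_def)
    show "Digraph_Component.connected ?C" using A by (simp add: conn_sets_def)
  next
    fix C' assume neq: "C' \<noteq> ?C" and sub: "subgraph ?C C'"
      and C': "subgraph C' (with_proj H \<restriction> S)" "Digraph_Component.connected C'"
    have "A \<subseteq> verts C'" using sub by (auto simp: subgraph_def)
    with A verts_connected_subgraph_in_conn_sets[OF C' S] have v: "verts C' = A" by blast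
    have "C' = ?C"
    proof (rule pre_digraph.equality)
      show "verts C' = verts ?C" by (simp add: v)
      show "arcs C' = arcs ?C"
      proof
        show "arcs ?C \<subseteq> arcs C'" using sub by (auto simp: subgraph_def)
        \<comment> \<open>Arcs of \<open>C'\<close> come from the graph induced by \<open>S\<close>
          and have both ends in \<open>A\<close>, so they survive in the graph induced by
          \<open>A\<close>.\<close>
        show "arcs C' \<subseteq> arcs ?C"
          using C'(1) wf_digraph.wellformed[of C']
          by (auto simp: subgraph_def induce_subgraph_def compatible_def v[symmetric] subset_iff)
      qed
    qed (use sub in \<open>auto simp: subgraph_def compatible_def\<close>)
    with neq show False by simp
  qed
  then show "A \<in> component_sets H S"
    unfolding component_sets_def by (intro image_eqI[where x = ?C]) auto
qed

lemma component_sets_subset_conn_sets: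
  "S \<subseteq> pverts H \<Longrightarrow> component_sets H S \<subseteq> conn_sets H"
  by (auto simp: component_sets_eq_maximal)

text \<open>For \<open>v\<close> in \<open>A\<close>, the union of all connected subsets of
  \<open>S\<close> through \<open>v\<close> is connected. It is maximal because a connected superset
  inside \<open>S\<close> also contains \<open>v\<close>.\<close>

lemma conn_set_subset_component:
  assumes S: "S \<subseteq> pverts H" and A: "A \<in> conn_sets H" "A \<subseteq> S"
  shows "\<exists>C\<in>component_sets H S. A \<subseteq> C"
proof -
  from A obtain v where v: "v \<in> A" by (auto simp: conn_sets_def)
  define F where "F = {B \<in> conn_sets H. B \<subseteq> S \<and> v \<in> B}"
  have AF: "A \<in> F" using A v by (simp add: F_def)
  have "\<Union>F \<in> conn_sets H"
    by (rule Union_in_conn_sets[of _ _ v]) (use AF in \<open>auto simp: F_def\<close>)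
  moreover have "\<Union>F \<subseteq> S" by (auto simp: F_def)
  moreover have "B = \<Union>F" if "B \<in> conn_sets H" "B \<subseteq> S" "\<Union>F \<subseteq> B" for B
  proof -
    have "B \<in> F" using that AF v by (auto simp: F_def)
    with that show ?thesis by blast
  qed
  ultimately have "\<Union>F \<in> component_sets H S"
    using S by (simp add: component_sets_eq_maximal)
  with AF show ?thesis by blast
qed

text \<open>Singletons are connected, so every vertex is covered; two components sharing a vertex
  have a connected union, which by maximality equals both.\<close>

lemma partition_on_component_sets:
  assumes S: "S \<subseteq> pverts H"
  shows "partition_on S (component_sets H S)"
proof (rule partition_onI)
  show "\<Union>(component_sets H S) = S"
  proof
    show "\<Union>(component_sets H S) \<subseteq> S" using S by (auto simp: component_sets_eq_maximal)
    show "S \<subseteq> \<Union>(component_sets H S)"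
    proof
      fix v assume "v \<in> S"
      then show "v \<in> \<Union>(component_sets H S)"
        using conn_set_subset_component[OF S, of "{v}"] singleton_in_conn_sets[of v H] S by auto
    qed
  qed
  show "{} \<notin> component_sets H S"
    using component_sets_subset_conn_sets[OF S] conn_sets_nonempty by blast
  fix p q assume pq: "p \<in> component_sets H S" "q \<in> component_sets H S" "p \<noteq> q"
  show "disjnt p q"
  proof (rule ccontr)
    assume "\<not> disjnt p q"
    then obtain v where "v \<in> p" "v \<in> q" by (auto simp: disjnt_iff)
    with pq S have "p \<union> q \<in> conn_sets H" "p \<union> q \<subseteq> S"
      by (auto simp: component_sets_eq_maximal intro: Un_in_conn_sets[of _ _ _ v v])
    with pq S have "p \<union> q = p" "p \<union> q = q" by (auto simp: component_sets_eq_maximal)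
    with pq show False by simp
  qed
qed

subsection \<open>Partitions into connected blocks\<close>

text \<open>The number of blocks is left free because the penalised recursion ranges over all these
  partitions.\<close>

definition conn_parts :: "nat pair_pre_digraph \<Rightarrow> nat set \<Rightarrow> nat set set set" where
  "conn_parts H S = {L. partition_on S L \<and> L \<subseteq> conn_sets H}"

lemma conn_partitions_eq: "conn_partitions H k S = {L \<in> conn_parts H S. card L = k}"
  by (auto simp: conn_partitions_def conn_parts_def)

lemma conn_partsD:
  assumes "L \<in> conn_parts H S"
  shows "\<Union>L = S" "A \<in> L \<Longrightarrow> A \<in> conn_sets H" "A \<in> L \<Longrightarrow> A \<subseteq> S" "A \<in> L \<Longrightarrow> A \<noteq> {}"
    "A \<in> L \<Longrightarrow> B \<in> L \<Longrightarrow> v \<in> A \<Longrightarrow> v \<in> B \<Longrightarrow> A = B"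
  using assms by (auto simp: conn_parts_def partition_on_def disjoint_def)

lemma conn_partsI:
  assumes "\<Union>L = S" "L \<subseteq> conn_sets H"
    and "\<And>A B v. A \<in> L \<Longrightarrow> B \<in> L \<Longrightarrow> v \<in> A \<Longrightarrow> v \<in> B \<Longrightarrow> A = B"
  shows "L \<in> conn_parts H S"
proof -
  have "partition_on S L"
  proof (rule partition_onI)
    show "\<Union>L = S" by fact
    show "{} \<notin> L" using assms(2) conn_sets_nonempty by blast
    show "disjnt A B" if "A \<in> L" "B \<in> L" "A \<noteq> B" for A B
      using that assms(3) unfolding disjnt_iff by blast
  qed
  with assms(2) show ?thesis by (simp add: conn_parts_def)
qed

lemma finite_conn_parts: "finite S \<Longrightarrow> finite (conn_parts H S)"
  using finitely_many_partition_on[of S] by (rule rev_finite_subset) (auto simp: conn_parts_def)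

lemma finite_conn_partitions: "finite S \<Longrightarrow> finite (conn_partitions H k S)"
  by (simp add: conn_partitions_eq finite_conn_parts)

lemma finite_in_conn_parts: "finite S \<Longrightarrow> L \<in> conn_parts H S \<Longrightarrow> finite L"
  by (auto simp: conn_parts_def intro: finite_elements)

lemma card_conn_parts_le:
  assumes "finite S" "L \<in> conn_parts H S"
  shows "card L \<le> card S"
proof -
  have fin: "finite A" if "A \<in> L" for A
    using conn_partsD(3)[OF assms(2) that] assms(1) by (rule finite_subset)
  have "card L = (\<Sum>A\<in>L. 1)" by simp
  also have "\<dots> \<le> (\<Sum>A\<in>L. card A)"
    using fin conn_partsD(4)[OF assms(2)] by (intro sum_mono) (simp add: Suc_le_eq card_gt_0_iff)
  also have "\<dots> = card S"
    using assms fin by (intro product_partition[symmetric]) (auto simp: conn_parts_def)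
  finally show ?thesis .
qed

lemma card_conn_parts_pos:
  assumes "finite S" "S \<noteq> {}" "L \<in> conn_parts H S"
  shows "1 \<le> card L"
  using assms finite_in_conn_parts[of S L H] conn_partsD(1)[of L H S]
  by (auto simp: Suc_le_eq card_gt_0_iff)

section \<open>Splitting a partition along the components\<close>

context
  fixes H :: "nat pair_pre_digraph" and S :: "nat set" and c :: nat and T :: "nat \<Rightarrow> nat set"
  assumes S: "S \<subseteq> pverts H" and fin: "finite S"
    and T: "bij_betw T {1..c} (component_sets H S)"
begin

lemma enumerated_component_in_conn_sets: "j \<in> {1..c} \<Longrightarrow> T j \<in> conn_sets H"
  using bij_betwE[OF T] component_sets_subset_conn_sets[OF S] by blast

lemma enumerated_components_disjoint:
  assumes "i \<in> {1..c}" "j \<in> {1..c}" "v \<in> T i" "v \<in> T j"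
  shows "i = j"
proof -
  have "T i \<in> component_sets H S" "T j \<in> component_sets H S"
    using bij_betwE[OF T] assms by blast+
  then have "T i = T j"
    using disjointD[OF partition_onD2[OF partition_on_component_sets[OF S]]] assms(3,4) by blast
  with bij_betw_imp_inj_on[OF T] show ?thesis using assms(1,2) by (rule inj_onD)
qed

lemma UN_enumerated_components: "(\<Union>j\<in>{1..c}. T j) = S"
  using T partition_onD1[OF partition_on_component_sets[OF S]] by (simp add: bij_betw_def)

lemma enumerated_component_subset: "j \<in> {1..c} \<Longrightarrow> T j \<subseteq> S"
  using UN_enumerated_components by blast

lemma finite_enumerated_component: "j \<in> {1..c} \<Longrightarrow> finite (T j)"
  using enumerated_component_subset fin by (rule finite_subset)

lemma conn_set_subset_enumerated_component:
  assumes "A \<in> conn_sets H" "A \<subseteq> S"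
  shows "\<exists>j\<in>{1..c}. A \<subseteq> T j"
proof -
  have "component_sets H S = T ` {1..c}" using T by (simp add: bij_betw_def)
  with conn_set_subset_component[OF S assms] show ?thesis by simp
qed

lemma UN_restrict_parts:
  assumes L: "L \<in> conn_parts H S"
  shows "(\<Union>j\<in>{1..c}. restrict_parts c T L j) = L"
proof (intro equalityI subsetI)
  fix A assume A: "A \<in> L"
  then obtain j where "j \<in> {1..c}" "A \<subseteq> T j"
    using conn_set_subset_enumerated_component conn_partsD(2,3)[OF L A] by blast
  with A show "A \<in> (\<Union>j\<in>{1..c}. restrict_parts c T L j)" by (auto simp: restrict_parts_def)
qed (auto simp: restrict_parts_def)

text \<open>The block of a vertex of \<open>T j\<close> lies in some component, which must be
  \<open>T j\<close>; hence the blocks inside \<open>T j\<close> cover it.\<close>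

lemma restrict_parts_in_PiE:
  assumes L: "L \<in> conn_parts H S"
  shows "restrict_parts c T L \<in> (\<Pi>\<^sub>E j\<in>{1..c}. conn_parts H (T j))"
proof -
  have "{A \<in> L. A \<subseteq> T j} \<in> conn_parts H (T j)" if j: "j \<in> {1..c}" for j
  proof (rule conn_partsI)
    show "\<Union>{A \<in> L. A \<subseteq> T j} = T j"
    proof (intro equalityI subsetI)
      fix v assume v: "v \<in> T j"
      then obtain A where A: "A \<in> L" "v \<in> A"
        using enumerated_component_subset[OF j] conn_partsD(1)[OF L] by blast
      then obtain i where i: "i \<in> {1..c}" "A \<subseteq> T i"
        using conn_set_subset_enumerated_component conn_partsD(2,3)[OF L] by blast
      with A v j have "i = j" by (intro enumerated_components_disjoint[of i j v]) auto
      with A i show "v \<in> \<Union>{A \<in> L. A \<subseteq> T j}" by blast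
    qed blast
    show "{A \<in> L. A \<subseteq> T j} \<subseteq> conn_sets H" using conn_partsD(2)[OF L] by blast
  qed (use conn_partsD(5)[OF L] in blast)
  then show ?thesis by (auto simp: restrict_parts_def)
qed

text \<open>Taking the union inverts restriction: blocks from different components cannot meet, and
  each block lies in only one component, so restricting returns each \<open>f j\<close>.\<close>

lemma restrict_parts_UN:
  assumes f: "f \<in> (\<Pi>\<^sub>E j\<in>{1..c}. conn_parts H (T j))"
  shows "(\<Union>j\<in>{1..c}. f j) \<in> conn_parts H S" "restrict_parts c T (\<Union>j\<in>{1..c}. f j) = f"
proof -
  have fj: "f j \<in> conn_parts H (T j)" if "j \<in> {1..c}" for j using f that by blast
  have index: "i = j" if "i \<in> {1..c}" "j \<in> {1..c}" "A \<in> f i" "v \<in> A" "v \<in> T j" for i j A v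
    using that conn_partsD(3)[OF fj[of i]] by (intro enumerated_components_disjoint[of i j v]) auto
  show "(\<Union>j\<in>{1..c}. f j) \<in> conn_parts H S"
  proof (rule conn_partsI)
    have "\<Union>(\<Union>j\<in>{1..c}. f j) = (\<Union>j\<in>{1..c}. \<Union>(f j))" by blast
    also have "\<dots> = S" using conn_partsD(1)[OF fj] UN_enumerated_components by simp
    finally show "\<Union>(\<Union>j\<in>{1..c}. f j) = S" .
    show "(\<Union>j\<in>{1..c}. f j) \<subseteq> conn_sets H" using conn_partsD(2)[OF fj] by blast
    fix A B v assume "A \<in> (\<Union>j\<in>{1..c}. f j)" "B \<in> (\<Union>j\<in>{1..c}. f j)" and v: "v \<in> A" "v \<in> B"
    then obtain i j where ij: "i \<in> {1..c}" "A \<in> f i" "j \<in> {1..c}" "B \<in> f j" by blast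
    then have "v \<in> T j" using v conn_partsD(3)[OF fj] by blast
    with ij v index have "i = j" by blast
    with ij v show "A = B" using conn_partsD(5)[OF fj] by blast
  qed
  have "{A \<in> \<Union>j\<in>{1..c}. f j. A \<subseteq> T j} = f j" if j: "j \<in> {1..c}" for j
  proof (intro equalityI subsetI)
    fix A assume "A \<in> {A \<in> \<Union>j\<in>{1..c}. f j. A \<subseteq> T j}"
    then obtain i where i: "i \<in> {1..c}" "A \<in> f i" "A \<subseteq> T j" by blast
    \<comment> \<open>Nonemptiness matters: an empty set would lie inside every component.\<close>
    then obtain v where "v \<in> A" using conn_partsD(4)[OF fj] by blast
    with i j index have "i = j" by blast
    with i show "A \<in> f j" by simp
  qed (use j conn_partsD(3)[OF fj] in blast)
  \<comment> \<open>Outside \<open>{1..c}\<close> both functions are \<open>undefined\<close>, so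
    they agree everywhere.\<close>
  with f show "restrict_parts c T (\<Union>j\<in>{1..c}. f j) = f"
    by (auto simp: restrict_parts_def fun_eq_iff PiE_def extensional_def)
qed

lemma bij_betw_restrict_parts:
  "bij_betw (restrict_parts c T) (conn_parts H S) (\<Pi>\<^sub>E j\<in>{1..c}. conn_parts H (T j))"
proof (rule bij_betw_byWitness[where f' = "\<lambda>f. \<Union>j\<in>{1..c}. f j"])
  show "\<forall>L\<in>conn_parts H S. (\<Union>j\<in>{1..c}. restrict_parts c T L j) = L"
    using UN_restrict_parts by (rule ballI)
  show "\<forall>f\<in>\<Pi>\<^sub>E j\<in>{1..c}. conn_parts H (T j). restrict_parts c T (\<Union>j\<in>{1..c}. f j) = f"
    using restrict_parts_UN(2) by (rule ballI)
  show "restrict_parts c T ` conn_parts H S \<subseteq> (\<Pi>\<^sub>E j\<in>{1..c}. conn_parts H (T j))"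
    using restrict_parts_in_PiE by (rule image_subsetI)
  show "(\<lambda>f. \<Union>j\<in>{1..c}. f j) ` (\<Pi>\<^sub>E j\<in>{1..c}. conn_parts H (T j)) \<subseteq> conn_parts H S"
    using restrict_parts_UN(1) by (rule image_subsetI)
qed

text \<open>Blocks are nonempty, so different components receive different blocks and sums can be
  grouped by component. The weight is generic in order to count blocks as well as to add plain and
  penalised costs.\<close>

lemma sum_restrict_parts:
  fixes w :: "nat set \<Rightarrow> 'a :: comm_monoid_add"
  assumes L: "L \<in> conn_parts H S"
  shows "(\<Sum>j = 1..c. \<Sum>A\<in>restrict_parts c T L j. w A) = (\<Sum>A\<in>L. w A)"
proof -
  have f: "restrict_parts c T L j \<in> conn_parts H (T j)" if "j \<in> {1..c}" for j
    using restrict_parts_in_PiE[OF L] that by blast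
  have "restrict_parts c T L i \<inter> restrict_parts c T L j = {}"
    if ij: "i \<in> {1..c}" "j \<in> {1..c}" "i \<noteq> j" for i j
  proof (rule ccontr)
    assume "\<not> ?thesis"
    then obtain A where A: "A \<in> restrict_parts c T L i" "A \<in> restrict_parts c T L j" by blast
    then obtain v where "v \<in> A" using conn_partsD(4)[OF f[OF ij(1)] A(1)] by blast
    with A ij have "v \<in> T i" "v \<in> T j"
      using conn_partsD(3)[OF f] by blast+
    with ij enumerated_components_disjoint show False by blast
  qed
  then have "(\<Sum>A\<in>(\<Union>j\<in>{1..c}. restrict_parts c T L j). w A) =
      (\<Sum>j = 1..c. \<Sum>A\<in>restrict_parts c T L j. w A)"
    using finite_in_conn_parts[OF finite_enumerated_component f]
    by (intro sum.UNION_disjoint) auto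
  then show ?thesis by (simp only: UN_restrict_parts[OF L])
qed

lemma sum_card_restrict_parts:
  "L \<in> conn_parts H S \<Longrightarrow> (\<Sum>j = 1..c. card (restrict_parts c T L j)) = card L"
  using sum_restrict_parts[of L "\<lambda>_. 1 :: nat"] by simp

text \<open>The restricted family already determines the partition, and the index merely records its
  block counts, which add up to \<open>k\<close>. Conversely, a family with counts
  \<open>\<kappa>\<close> glues to a partition with \<open>k\<close> blocks.\<close>

lemma bij_betw_split_partition:
  "bij_betw (split_partition c T) (conn_partitions H k S)
     (SIGMA \<kappa>:size_tuples c T k. \<Pi>\<^sub>E j\<in>{1..c}. conn_partitions H (\<kappa> j) (T j))"
  unfolding bij_betw_def
proof (intro conjI equalityI subsetI)
  show "inj_on (split_partition c T) (conn_partitions H k S)"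
    using bij_betw_restrict_parts
    by (auto simp: inj_on_def bij_betw_def split_partition_def conn_partitions_eq)
next
  fix y assume "y \<in> split_partition c T ` conn_partitions H k S"
  then obtain L where L: "L \<in> conn_parts H S" "card L = k" and y: "y = split_partition c T L"
    by (auto simp: conn_partitions_eq)
  have f: "restrict_parts c T L j \<in> conn_parts H (T j)" if "j \<in> {1..c}" for j
    using restrict_parts_in_PiE[OF L(1)] that by blast
  \<comment> \<open>The lower bound holds because components are nonempty, the upper one because
    blocks are.\<close>
  have "card (restrict_parts c T L j) \<in> {1..card (T j)}" if j: "j \<in> {1..c}" for j
    using card_conn_parts_le[OF finite_enumerated_component[OF j] f[OF j]]
      card_conn_parts_pos[OF finite_enumerated_component[OF j] _ f[OF j]]
      conn_sets_nonempty[OF enumerated_component_in_conn_sets[OF j]] by simp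
  moreover have "(\<Sum>j = 1..c. card (restrict_parts c T L j)) = k"
    using sum_card_restrict_parts L by simp
  moreover have "restrict_parts c T L \<in> extensional {1..c}" by (simp add: restrict_parts_def)
  ultimately show "y \<in> (SIGMA \<kappa>:size_tuples c T k. \<Pi>\<^sub>E j\<in>{1..c}. conn_partitions H (\<kappa> j) (T j))"
    using f by (auto simp: y split_partition_def size_tuples_def conn_partitions_eq PiE_def)
next
  fix y assume "y \<in> (SIGMA \<kappa>:size_tuples c T k. \<Pi>\<^sub>E j\<in>{1..c}. conn_partitions H (\<kappa> j) (T j))"
  then obtain \<kappa> f where y: "y = (\<kappa>, f)" and \<kappa>: "\<kappa> \<in> size_tuples c T k"
    and f: "f \<in> (\<Pi>\<^sub>E j\<in>{1..c}. conn_partitions H (\<kappa> j) (T j))" by blast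
  define L where "L = (\<Union>j\<in>{1..c}. f j)"
  have f': "f \<in> (\<Pi>\<^sub>E j\<in>{1..c}. conn_parts H (T j))"
    using f by (auto simp: conn_partitions_eq PiE_iff)
  note L = restrict_parts_UN[OF f', folded L_def]
  have card: "card (f j) = \<kappa> j" if "j \<in> {1..c}" for j
    using f that by (auto simp: conn_partitions_eq PiE_iff)
  have "(\<lambda>j\<in>{1..c}. card (f j)) = \<kappa>"
    using card \<kappa> by (auto simp: fun_eq_iff size_tuples_def PiE_def extensional_def)
  then have "split_partition c T L = y"
    using L(2) by (simp add: split_partition_def y)
  moreover have "card L = k"
    using sum_card_restrict_parts[OF L(1)] \<kappa> card by (simp add: L(2) size_tuples_def)
  ultimately show "y \<in> split_partition c T ` conn_partitions H k S"
    using L(1) by (auto simp: conn_partitions_eq)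
qed

section \<open>Merging blocks and the possible numbers of blocks\<close>

text \<open>By pigeonhole two blocks share a component, so one of them, \<open>A\<close>, is a
  proper part of it, and connectedness gives an edge leaving \<open>A\<close> inside the component.
  Merging \<open>A\<close> with the block at the far end lowers the count by one.\<close>

lemma merge_conn_partition:
  assumes L: "L \<in> conn_partitions H (Suc k) S" and k: "c \<le> k"
  shows "conn_partitions H k S \<noteq> {}"
proof -
  have LS: "L \<in> conn_parts H S" and cardL: "card L = Suc k"
    using L by (auto simp: conn_partitions_eq)
  have "\<exists>j. j \<in> {1..c} \<and> A \<subseteq> T j" if "A \<in> L" for A
    using conn_set_subset_enumerated_component conn_partsD(2,3)[OF LS that] by blast
  then obtain g where g: "\<And>A. A \<in> L \<Longrightarrow> g A \<in> {1..c} \<and> A \<subseteq> T (g A)" by metis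
  have "\<not> inj_on g L"
  proof
    assume "inj_on g L"
    then have "card L \<le> card {1..c}" using g by (intro card_inj_on_le[of g]) auto
    with cardL k show False by simp
  qed
  then obtain A A' where A: "A \<in> L" "A' \<in> L" "A \<noteq> A'" "g A = g A'" by (auto simp: inj_on_def)
  obtain v where "v \<in> A'" using conn_partsD(4)[OF LS A(2)] by blast
  then have v: "v \<in> T (g A)" "v \<notin> A" using g[OF A(2)] A conn_partsD(5)[OF LS] by auto
  have "\<exists>a\<in>A. \<exists>b\<in>T (g A) - A. (a, b) \<in> (parcs H)\<^sup>s"
    by (rule conn_sets_cut[OF enumerated_component_in_conn_sets])
      (use g[OF A(1)] v conn_partsD(4)[OF LS A(1)] in auto)
  then obtain a b where ab: "a \<in> A" "b \<in> T (g A)" "b \<notin> A" "(a, b) \<in> (parcs H)\<^sup>s" by blast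
  have "b \<in> S" using ab g[OF A(1)] enumerated_component_subset by blast
  \<comment> \<open>\<open>B\<close> may differ from \<open>A'\<close>, which served only to show
    that \<open>A\<close> does not fill its component.\<close>
  then obtain B where B: "B \<in> L" "b \<in> B" using conn_partsD(1)[OF LS] by blast
  have AB: "A \<noteq> B" using B ab by blast
  have "A \<union> B \<in> conn_sets H"
    using conn_partsD(2)[OF LS] A B ab by (intro Un_in_conn_sets[of A H B a b]) auto
  define M where "M = insert (A \<union> B) (L - {A, B})"
  have "M \<in> conn_parts H S"
  proof (rule conn_partsI)
    show "\<Union>M = S" using conn_partsD(1)[OF LS] A B by (auto simp: M_def)
    show "M \<subseteq> conn_sets H"
      using conn_partsD(2)[OF LS] \<open>A \<union> B \<in> conn_sets H\<close> by (auto simp: M_def)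
    fix P Q u assume "P \<in> M" "Q \<in> M" "u \<in> P" "u \<in> Q"
    then show "P = Q" using conn_partsD(5)[OF LS] A(1) B(1) unfolding M_def by blast
  qed
  moreover have "card M = k"
  proof -
    \<comment> \<open>The merged block is new: an old block containing \<open>a\<close> would be
      \<open>A\<close>, which was removed.\<close>
    have "A \<union> B \<notin> L - {A, B}"
    proof
      assume "A \<union> B \<in> L - {A, B}"
      then have "A \<union> B = A" using conn_partsD(5)[OF LS, of "A \<union> B" A a] A ab by blast
      with \<open>A \<union> B \<in> L - {A, B}\<close> show False by simp
    qed
    moreover have "card (L - {A, B}) = card L - 2"
      using A B AB by (subst card_Diff_subset) auto
    moreover have "2 \<le> card L"
      using card_mono[of L "{A, B}"] A B AB finite_in_conn_parts[OF fin LS] by auto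
    ultimately show ?thesis
      using finite_in_conn_parts[OF fin LS] cardL by (simp add: M_def)
  qed
  ultimately show ?thesis by (auto simp: conn_partitions_eq)
qed

text \<open>Each component takes at least one block and each block at least one vertex. Conversely,
  singletons realise \<open>card S\<close>, and merging descends from there.\<close>

lemma conn_partitions_nonempty_iff: "conn_partitions H k S \<noteq> {} \<longleftrightarrow> c \<le> k \<and> k \<le> card S"
proof
  assume "conn_partitions H k S \<noteq> {}"
  then obtain L where L: "L \<in> conn_parts H S" "card L = k" by (auto simp: conn_partitions_eq)
  then have "split_partition c T L \<in>
      (SIGMA \<kappa>:size_tuples c T k. \<Pi>\<^sub>E j\<in>{1..c}. conn_partitions H (\<kappa> j) (T j))"
    using bij_betwE[OF bij_betw_split_partition, of k] by (auto simp: conn_partitions_eq)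
  then obtain \<kappa> where \<kappa>: "\<kappa> \<in> size_tuples c T k" by blast
  have "c = (\<Sum>j = 1..c. 1)" by simp
  also have "\<dots> \<le> (\<Sum>j = 1..c. \<kappa> j)"
    using \<kappa> by (intro sum_mono) (auto simp: size_tuples_def PiE_iff)
  also have "\<dots> = k" using \<kappa> by (simp add: size_tuples_def)
  finally show "c \<le> k \<and> k \<le> card S" using card_conn_parts_le[OF fin L(1)] L(2) by simp
next
  assume k: "c \<le> k \<and> k \<le> card S"
  then have "k \<le> card S" by simp
  then show "conn_partitions H k S \<noteq> {}"
    using k[THEN conjunct1]
  \<comment> \<open>The induction runs downward from \<open>card S\<close>; \<open>c \<le> k\<close>
    is carried along because every merge requires it.\<close>
  proof (induction k rule: inc_induct)
    case base
    have "(\<lambda>v. {v}) ` S \<in> conn_partitions H (card S) S"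
      using S by (auto simp: conn_partitions_def partition_on_singletons card_image
          intro: singleton_in_conn_sets)
    then show ?case by blast
  next
    case (step k)
    then show ?case using merge_conn_partition by fastforce
  qed
qed

end

subsection \<open>The recursions as infima over partitions\<close>

text \<open>The convention for the empty set agrees with the lattice infimum, so lattice laws apply
  without separating infeasible cases.\<close>

lemma min_or_infinity_eq_Inf: "finite X \<Longrightarrow> min_or_infinity X = Inf X"
  by (simp add: min_or_infinity_def Min_Inf top_ereal_def)

text \<open>A finite shift can be undone by subtraction. An empty \<open>I\<close> is covered: both
  sides are then infinite.\<close>

lemma INF_ereal_add_real_left:
  fixes f :: "'a \<Rightarrow> ereal"
  shows "(INF i\<in>I. ereal a + f i) = ereal a + (INF i\<in>I. f i)"
proof (rule antisym)
  have "(INF i\<in>I. ereal a + f i) - ereal a \<le> (INF i\<in>I. f i)"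
  proof (rule INF_greatest)
    fix i assume "i \<in> I"
    then have "(INF i\<in>I. ereal a + f i) \<le> f i + ereal a"
      by (intro INF_lower2[of i]) (simp_all add: add.commute)
    then show "(INF i\<in>I. ereal a + f i) - ereal a \<le> f i"
      by (simp add: ereal_minus_le)
  qed
  then show "(INF i\<in>I. ereal a + f i) \<le> ereal a + (INF i\<in>I. f i)"
    by (simp add: ereal_minus_le add.commute)
  show "ereal a + (INF i\<in>I. f i) \<le> (INF i\<in>I. ereal a + f i)"
    by (intro INF_greatest add_left_mono INF_lower)
qed

lemma INF_UNION:
  "(INF x\<in>(\<Union>y\<in>A. g y). f x) = (INF y\<in>A. INF x\<in>g y. f x :: _ :: complete_lattice)"
  by (rule antisym) (blast intro: INF_greatest INF_lower2)+

text \<open>Coordinates are chosen independently, so picking a minimiser in each is optimal. An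
  empty factor makes the product empty and both sides infinite.\<close>

lemma INF_PiE_sum:
  fixes g :: "'i \<Rightarrow> 'a \<Rightarrow> real"
  assumes I: "finite I" and X: "\<And>i. i \<in> I \<Longrightarrow> finite (X i)"
  shows "(INF f\<in>Pi\<^sub>E I X. ereal (\<Sum>i\<in>I. g i (f i))) = (\<Sum>i\<in>I. INF a\<in>X i. ereal (g i a))"
proof (rule antisym)
  show "(\<Sum>i\<in>I. INF a\<in>X i. ereal (g i a)) \<le> (INF f\<in>Pi\<^sub>E I X. ereal (\<Sum>i\<in>I. g i (f i)))"
  proof (rule INF_greatest)
    fix f assume "f \<in> Pi\<^sub>E I X"
    then have "(\<Sum>i\<in>I. INF a\<in>X i. ereal (g i a)) \<le> (\<Sum>i\<in>I. ereal (g i (f i)))"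
      by (intro sum_mono INF_lower) auto
    then show "(\<Sum>i\<in>I. INF a\<in>X i. ereal (g i a)) \<le> ereal (\<Sum>i\<in>I. g i (f i))"
      by simp
  qed
  show "(INF f\<in>Pi\<^sub>E I X. ereal (\<Sum>i\<in>I. g i (f i))) \<le> (\<Sum>i\<in>I. INF a\<in>X i. ereal (g i a))"
  proof (cases "\<exists>i\<in>I. X i = {}")
    case True
    then obtain j where "j \<in> I" "(INF a\<in>X j. ereal (g j a)) = \<infinity>"
      by (auto simp: top_ereal_def)
    then have "(\<Sum>i\<in>I. INF a\<in>X i. ereal (g i a)) = \<infinity>"
      using I unfolding sum_Pinfty by blast
    then show ?thesis by simp
  next
    case False
    have "\<exists>a\<in>X i. (INF a\<in>X i. ereal (g i a)) = ereal (g i a)" if i: "i \<in> I" for i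
    proof -
      have "Min ((\<lambda>a. ereal (g i a)) ` X i) \<in> (\<lambda>a. ereal (g i a)) ` X i"
        using False X i by (intro Min_in) auto
      moreover have "Min ((\<lambda>a. ereal (g i a)) ` X i) = (INF a\<in>X i. ereal (g i a))"
        using False X i by (intro Min_Inf) auto
      ultimately show ?thesis by auto
    qed
    then obtain m where m: "\<And>i. i \<in> I \<Longrightarrow> m i \<in> X i"
      "\<And>i. i \<in> I \<Longrightarrow> (INF a\<in>X i. ereal (g i a)) = ereal (g i (m i))" by metis
    have "restrict m I \<in> Pi\<^sub>E I X" using m(1) by simp
    then have "(INF f\<in>Pi\<^sub>E I X. ereal (\<Sum>i\<in>I. g i (f i))) \<le> ereal (\<Sum>i\<in>I. g i (restrict m I i))"
      by (rule INF_lower)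
    also have "\<dots> = (\<Sum>i\<in>I. INF a\<in>X i. ereal (g i a))"
      using m(2) by simp
    finally show ?thesis .
  qed
qed

section \<open>Splitting off the block of the least element\<close>

lemma finite_root_blocks: "finite S \<Longrightarrow> finite (root_blocks H S)"
  by (rule finite_subset[of _ "Pow S"]) (auto simp: root_blocks_def)

lemma insert_root_block:
  assumes B: "B \<in> conn_sets H" "B \<subseteq> S" and L: "L \<in> conn_parts H (S - B)"
  shows "insert B L \<in> conn_parts H S" "B \<notin> L"
proof -
  show "B \<notin> L" using conn_partsD(3,4)[OF L] conn_sets_nonempty[OF B(1)] by blast
  show "insert B L \<in> conn_parts H S"
  proof (rule conn_partsI)
    show "\<Union>(insert B L) = S" using conn_partsD(1)[OF L] B by auto
    show "insert B L \<subseteq> conn_sets H" using conn_partsD(2)[OF L] B by auto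
    fix P Q v assume PQ: "P \<in> insert B L" "Q \<in> insert B L" "v \<in> P" "v \<in> Q"
    have "v \<notin> B" if "C \<in> L" "v \<in> C" for C using conn_partsD(3)[OF L] that by blast
    then show "P = Q" using PQ conn_partsD(5)[OF L] by (elim insertE) blast+
  qed
qed

text \<open>The block containing \<open>Min S\<close> is an admissible first choice of the
  recursion. Its removal leaves a partition of the rest because the other blocks are disjoint from
  it.\<close>

lemma conn_parts_root_block:
  assumes S: "finite S" "S \<noteq> {}" and L: "L \<in> conn_parts H S"
  obtains B M where "B \<in> root_blocks H S" "M \<in> conn_parts H (S - B)" "L = insert B M"
proof -
  obtain B where B: "B \<in> L" "Min S \<in> B"
    using Min_in[OF S] conn_partsD(1)[OF L] by blast
  show ?thesis
  proof
    show "B \<in> root_blocks H S"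
      using B conn_partsD(2,3)[OF L] by (auto simp: root_blocks_def)
    show "L = insert B (L - {B})" using B by blast
    show "L - {B} \<in> conn_parts H (S - B)"
    proof (rule conn_partsI)
      show "\<Union>(L - {B}) = S - B"
        using conn_partsD(1)[OF L] conn_partsD(5)[OF L _ B(1)] by blast
      show "L - {B} \<subseteq> conn_sets H" using conn_partsD(2)[OF L] by blast
      show "P = Q" if "P \<in> L - {B}" "Q \<in> L - {B}" "v \<in> P" "v \<in> Q" for P Q v
        using conn_partsD(5)[OF L] that by blast
    qed
  qed
qed

lemma conn_parts_eq_UN_root_blocks:
  assumes S: "finite S" "S \<noteq> {}"
  shows "conn_parts H S = (\<Union>B\<in>root_blocks H S. insert B ` conn_parts H (S - B))"
proof (intro equalityI subsetI)
  fix L assume "L \<in> conn_parts H S"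
  then show "L \<in> (\<Union>B\<in>root_blocks H S. insert B ` conn_parts H (S - B))"
    by (rule conn_parts_root_block[OF S]) blast
next
  fix L assume "L \<in> (\<Union>B\<in>root_blocks H S. insert B ` conn_parts H (S - B))"
  then show "L \<in> conn_parts H S"
    by (auto simp: root_blocks_def intro: insert_root_block(1))
qed

lemma root_blocks_card_subset: "root_blocks_card H S k \<subseteq> root_blocks H S"
  by (auto simp: root_blocks_card_def root_blocks_def)

text \<open>The size bound in \<open>root_blocks_card\<close> excludes no partition: the other
  \<open>k\<close> blocks are nonempty and take up at least \<open>k\<close> elements outside
  \<open>B\<close>.\<close>

lemma conn_partitions_eq_UN_root_blocks:
  assumes S: "finite S" "S \<noteq> {}" and k: "Suc k \<le> card S"
  shows "conn_partitions H (Suc k) S =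
    (\<Union>B\<in>root_blocks_card H S (Suc k). insert B ` conn_partitions H k (S - B))"
proof (intro equalityI subsetI)
  fix L assume L: "L \<in> conn_partitions H (Suc k) S"
  then obtain B M where B: "B \<in> root_blocks H S" and M: "M \<in> conn_parts H (S - B)"
    and LBM: "L = insert B M"
    using conn_parts_root_block[OF S, of L H] by (auto simp: conn_partitions_eq)
  have BS: "B \<in> conn_sets H" "B \<subseteq> S" using B by (auto simp: root_blocks_def)
  have "finite M" using finite_in_conn_parts[OF _ M] S by simp
  then have cardM: "card M = k"
    using L insert_root_block(2)[OF BS M] by (simp add: LBM conn_partitions_eq)
  have "k \<le> card (S - B)" using card_conn_parts_le[OF _ M] S cardM by simp
  also have "\<dots> = card S - card B"
    using BS S by (intro card_Diff_subset) (auto intro: finite_subset)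
  \<comment> \<open>The bound is \<open>card S - k\<close> in disguise, since
    \<open>Suc k \<le> card S\<close> prevents truncation.\<close>
  finally have "card B \<le> card S - Suc k + 1"
    using k card_mono[OF S(1) BS(2)] by linarith
  then have "B \<in> root_blocks_card H S (Suc k)"
    using B by (auto simp: root_blocks_def root_blocks_card_def)
  then show "L \<in> (\<Union>B\<in>root_blocks_card H S (Suc k). insert B ` conn_partitions H k (S - B))"
    using M cardM by (auto simp: LBM conn_partitions_eq)
next
  fix L assume "L \<in> (\<Union>B\<in>root_blocks_card H S (Suc k). insert B ` conn_partitions H k (S - B))"
  then obtain B M where B: "B \<in> conn_sets H" "B \<subseteq> S" and M: "M \<in> conn_parts H (S - B)"
    and "card M = k" "L = insert B M"
    by (auto simp: root_blocks_card_def conn_partitions_eq)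
  moreover have "finite M" using finite_in_conn_parts[OF _ M] S by simp
  ultimately show "L \<in> conn_partitions H (Suc k) S"
    using insert_root_block[OF B M] by (simp add: conn_partitions_eq)
qed

text \<open>\<open>B\<close> is not among the remaining blocks, so its weight enters every sum once
  and can be taken out. Generic \<open>P\<close> and \<open>w\<close> serve both recursions.\<close>

lemma INF_insert_root_block:
  fixes w :: "nat set \<Rightarrow> real"
  assumes S: "finite S" and B: "B \<in> conn_sets H" "B \<subseteq> S" and P: "P \<subseteq> conn_parts H (S - B)"
  shows "(INF L\<in>insert B ` P. ereal (\<Sum>A\<in>L. w A)) = ereal (w B) + (INF L\<in>P. ereal (\<Sum>A\<in>L. w A))"
proof -
  have "(\<Sum>A\<in>insert B L. w A) = w B + (\<Sum>A\<in>L. w A)" if "L \<in> P" for L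
    using that P S insert_root_block(2)[OF B, of L] finite_in_conn_parts[of "S - B" L H]
    by (subst sum.insert) auto
  then have "(INF L\<in>insert B ` P. ereal (\<Sum>A\<in>L. w A)) =
      (INF L\<in>P. ereal (w B) + ereal (\<Sum>A\<in>L. w A))"
    unfolding image_image by (intro INF_cong refl) simp
  then show ?thesis by (simp only: INF_ereal_add_real_left)
qed

text \<open>Choosing a root block and then an optimal rest runs through all partitions. Where no
  partition exists, the infimum over the empty set matches the infinite value of the
  recursion.\<close>

lemma opt_card_eq_INF:
  assumes "finite S"
  shows "opt_card H x S k = (INF L\<in>conn_partitions H k S. ereal (\<Sum>A\<in>L. sse x A))"
  using assms
proof (induction k arbitrary: S)
  case 0
  show ?case
  proof (cases "S = {}")
    case True
    then have "conn_partitions H 0 S = {{}}"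
      by (auto simp: conn_partitions_def partition_on_empty)
    with True show ?thesis by (simp add: opt_card.simps zero_ereal_def)
  next
    case False
    then have "conn_partitions H 0 S = {}"
      using card_conn_parts_pos[OF 0] by (fastforce simp: conn_partitions_eq)
    with False show ?thesis by (simp add: opt_card.simps top_ereal_def)
  qed
next
  case (Suc k)
  show ?case
  proof (cases "Suc k \<le> card S")
    case False
    then have "conn_partitions H (Suc k) S = {}"
      using card_conn_parts_le[OF Suc.prems] by (fastforce simp: conn_partitions_eq)
    with False show ?thesis by (simp add: opt_card.simps top_ereal_def)
  next
    case True
    then have S: "S \<noteq> {}" by auto
    have "finite (root_blocks_card H S (Suc k))"
      using finite_root_blocks[OF Suc.prems] root_blocks_card_subset by (rule rev_finite_subset)
    then have "opt_card H x S (Suc k) = (INF B\<in>root_blocks_card H S (Suc k).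
        ereal (sse x B) + opt_card H x (S - B) k)"
      using True S by (simp add: opt_card.simps[of H x S] min_or_infinity_eq_Inf)
    also have "\<dots> = (INF B\<in>root_blocks_card H S (Suc k).
        INF L\<in>insert B ` conn_partitions H k (S - B). ereal (\<Sum>A\<in>L. sse x A))"
    proof (rule INF_cong[OF refl])
      fix B assume "B \<in> root_blocks_card H S (Suc k)"
      then have "B \<in> conn_sets H" "B \<subseteq> S" by (auto simp: root_blocks_card_def)
      with Suc.prems show "ereal (sse x B) + opt_card H x (S - B) k =
          (INF L\<in>insert B ` conn_partitions H k (S - B). ereal (\<Sum>A\<in>L. sse x A))"
        by (subst INF_insert_root_block) (auto simp: Suc.IH conn_partitions_eq)
    qed
    also have "\<dots> = (INF L\<in>conn_partitions H (Suc k) S. ereal (\<Sum>A\<in>L. sse x A))"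
      by (simp only: conn_partitions_eq_UN_root_blocks[OF Suc.prems S True] INF_UNION)
    finally show ?thesis .
  qed
qed

text \<open>The penalty is charged once per block, so it is absorbed into the block weight
  \<open>sse x A + l\<close>.\<close>

lemma opt_pen_eq_INF:
  assumes "finite S"
  shows "opt_pen H x l S = (INF L\<in>conn_parts H S. ereal (\<Sum>A\<in>L. sse x A + l))"
  using assms
proof (induction S rule: finite_psubset_induct)
  case (psubset S)
  show ?case
  proof (cases "S = {}")
    case True
    then have "conn_parts H S = {{}}" by (auto simp: conn_parts_def partition_on_empty)
    with True show ?thesis by (simp add: opt_pen.simps zero_ereal_def)
  next
    case False
    have "opt_pen H x l S = (INF B\<in>root_blocks H S.
        ereal (sse x B) + ereal l + opt_pen H x l (S - B))"
      using False psubset.hyps finite_root_blocks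
      by (simp add: opt_pen.simps[of H x l S] min_or_infinity_eq_Inf)
    also have "\<dots> = (INF B\<in>root_blocks H S.
        INF L\<in>insert B ` conn_parts H (S - B). ereal (\<Sum>A\<in>L. sse x A + l))"
    proof (rule INF_cong[OF refl])
      fix B assume "B \<in> root_blocks H S"
      \<comment> \<open>\<open>Min S\<close> lies in both \<open>S\<close> and \<open>B\<close>, so
        \<open>S - B\<close> is a proper subset and the induction hypothesis applies.\<close>
      then have B: "B \<in> conn_sets H" "B \<subseteq> S" "S - B \<subset> S"
        using Min_in[OF psubset.hyps False] by (auto simp: root_blocks_def)
      have "ereal (sse x B) + ereal l + opt_pen H x l (S - B) =
          ereal (sse x B + l) + (INF L\<in>conn_parts H (S - B). ereal (\<Sum>A\<in>L. sse x A + l))"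
        using psubset.IH[OF B(3)] by simp
      also have "\<dots> = (INF L\<in>insert B ` conn_parts H (S - B). ereal (\<Sum>A\<in>L. sse x A + l))"
        by (rule INF_insert_root_block[symmetric, OF psubset.hyps B(1,2) subset_refl])
      finally show "ereal (sse x B) + ereal l + opt_pen H x l (S - B) =
          (INF L\<in>insert B ` conn_parts H (S - B). ereal (\<Sum>A\<in>L. sse x A + l))" .
    qed
    also have "\<dots> = (INF L\<in>conn_parts H S. ereal (\<Sum>A\<in>L. sse x A + l))"
      by (simp only: conn_parts_eq_UN_root_blocks[OF psubset.hyps False] INF_UNION)
    finally show ?thesis .
  qed
qed

section \<open>Assembling the formulas over the components\<close>

lemma finite_size_tuples: "finite (size_tuples c T k)"
  by (rule finite_subset[of _ "\<Pi>\<^sub>E j\<in>{1..c}. {1..card (T j)}"])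
    (auto simp: size_tuples_def intro!: finite_PiE)

theorem proposition1:
  fixes H :: "nat pair_pre_digraph" and n :: nat and x :: "nat \<Rightarrow> real ^ 'd" and lam :: real
    and S :: "nat set" and k c :: nat and T :: "nat \<Rightarrow> nat set"
  assumes "pair_graph H" and "pverts H = {1..n}"
    and "lam > 0"
    and "S \<noteq> {}" and "S \<subseteq> {1..n}"
    and "bij_betw T {1..c} (component_sets H S)"
  shows "bij_betw (split_partition c T)
           (conn_partitions H k S)
           (SIGMA \<kappa>:size_tuples c T k. \<Pi>\<^sub>E j\<in>{1..c}. conn_partitions H (\<kappa> j) (T j))
       \<and> opt_card H x S k =
           min_or_infinity ((\<lambda>\<kappa>. \<Sum>j = 1..c. opt_card H x (T j) (\<kappa> j)) ` size_tuples c T k)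
       \<and> opt_pen H x lam S = (\<Sum>j = 1..c. opt_pen H x lam (T j))
       \<and> (conn_partitions H k S \<noteq> {} \<longleftrightarrow> c \<le> k \<and> k \<le> card S)"
proof -
  have S: "S \<subseteq> pverts H" and fin: "finite S" using assms(2,5) by (auto intro: finite_subset)
  note enum = S fin assms(6)
  note finT = finite_enumerated_component[OF enum]
  let ?\<Sigma> = "SIGMA \<kappa>:size_tuples c T k. \<Pi>\<^sub>E j\<in>{1..c}. conn_partitions H (\<kappa> j) (T j)"
  have bij: "bij_betw (split_partition c T) (conn_partitions H k S) ?\<Sigma>"
    by (rule bij_betw_split_partition[OF enum])
  have "opt_card H x S k = (INF L\<in>conn_partitions H k S. ereal (\<Sum>A\<in>L. sse x A))"
    by (rule opt_card_eq_INF[OF fin])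
  \<comment> \<open>The cost is grouped by component and written through \<open>snd\<close>, so that
    it depends on \<open>L\<close> only via its image and can be moved along the bijection.\<close>
  also have "\<dots> = (INF L\<in>conn_partitions H k S.
      ereal (\<Sum>j = 1..c. \<Sum>A\<in>snd (split_partition c T L) j. sse x A))"
    by (rule INF_cong[OF refl])
      (simp add: split_partition_def conn_partitions_eq
        sum_restrict_parts[OF enum, where w = "sse x", symmetric])
  also have "\<dots> = (INF y\<in>?\<Sigma>. ereal (\<Sum>j = 1..c. \<Sum>A\<in>snd y j. sse x A))"
    unfolding bij_betw_imp_surj_on[OF bij, symmetric] by (simp only: image_image)
  also have "\<dots> = (INF \<kappa>\<in>size_tuples c T k. INF f\<in>(\<Pi>\<^sub>E j\<in>{1..c}. conn_partitions H (\<kappa> j) (T j)).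
      ereal (\<Sum>j = 1..c. \<Sum>A\<in>f j. sse x A))"
    by (simp only: INF_Sigma)
  \<comment> \<open>For fixed \<open>\<kappa>\<close> the partitions of the components vary
    independently, so the inner infimum becomes a sum of optima.\<close>
  also have "\<dots> = (INF \<kappa>\<in>size_tuples c T k. \<Sum>j = 1..c. opt_card H x (T j) (\<kappa> j))"
    by (intro INF_cong refl, subst INF_PiE_sum)
      (use finT in \<open>auto simp: opt_card_eq_INF finite_conn_partitions\<close>)
  also have "\<dots> = min_or_infinity
      ((\<lambda>\<kappa>. \<Sum>j = 1..c. opt_card H x (T j) (\<kappa> j)) ` size_tuples c T k)"
    by (simp add: min_or_infinity_eq_Inf finite_size_tuples)
  finally have card: "opt_card H x S k = \<dots>" .
  have "opt_pen H x lam S = (INF L\<in>conn_parts H S. ereal (\<Sum>A\<in>L. sse x A + lam))"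
    by (rule opt_pen_eq_INF[OF fin])
  \<comment> \<open>With the number of blocks free, the index tuple disappears and the product
    bijection alone decouples the components.\<close>
  also have "\<dots> = (INF L\<in>conn_parts H S.
      ereal (\<Sum>j = 1..c. \<Sum>A\<in>restrict_parts c T L j. sse x A + lam))"
    by (rule INF_cong[OF refl]) (simp only: sum_restrict_parts[OF enum])
  also have "\<dots> = (INF f\<in>(\<Pi>\<^sub>E j\<in>{1..c}. conn_parts H (T j)).
      ereal (\<Sum>j = 1..c. \<Sum>A\<in>f j. sse x A + lam))"
    unfolding bij_betw_imp_surj_on[OF bij_betw_restrict_parts[OF enum], symmetric]
    by (simp only: image_image)
  also have "\<dots> = (\<Sum>j = 1..c. opt_pen H x lam (T j))"
    by (subst INF_PiE_sum) (use finT in \<open>auto simp: opt_pen_eq_INF finite_conn_parts\<close>)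
  finally have pen: "opt_pen H x lam S = \<dots>" .
  from bij card pen conn_partitions_nonempty_iff[OF enum, of k] show ?thesis by blast
qed

end
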